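(* Let $D_2=(V,A)$ be the digraph with vertex set $V=\{v_1,v_2,v_3,v_4,v_6\}$ and arc set $A=\{(v_2,v_1),(v_2,v_3),(v_4,v_1),(v_4,v_3),(v_6,v_1),(v_6,v_2),(v_6,v_3)\}$ (where $v_1,v_2,v_3,v_4,v_6$ represent holomorphic, CR, anti-invariant, slant and hemi-slant submanifolds of almost Hermitian manifolds, respectively). Then: (i) $D_2$ is a three-partite digraph; (ii) the maximum size of a matching of $D_2$ is $2$; (iii) the independence number of $D_2$ is $2$; (iv) the chromatic number of $D_2$ is $3$; (v) $D_2$ has no directed spanning tree; (vi) the domination number of $D_2$ is $2$.
   Context: An arc $(u,v)$ goes from $u$ to $v$. The geometric meaning of the vertices plays no role in the statement; the digraph is the explicit one given. Definitions for a digraph $D=(V,A)$: - $D$ is $p$-partite if $V$ can be partitioned into $p$ nonempty sets such that no arc joins two vertices of the same set. - A matching is a set of arcs, none a loop, no two of which share an end-vertex. - A set of vertices is independent if there are no arcs between its members. The independence number is the maximum size of an independent set. The chromatic number is the minimum number of sets in a partition of $V$ into independent sets. - A directed spanning tree of $D$ with root $r\in V$ is a subdigraph $T$ of $D$ with $V(T)=V$ whose underlying undirected graph is a tree and in which there is a unique directed path from $r$ to each $v\in V\setminus\{r\}$. "$D$ has a directed spanning tree" means one exists for some root $r$. - A dominating set is a set $S\subseteq V$ such that for every $v\in V\setminus S$ there is $u\in S$ with $(u,v)\in A$. The domination number is the minimum cardinality of a dominating set. *)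

theory Defs
  imports "HOL-Library.Disjoint_Sets" "Graph_Theory.Graph_Theory"
begin

text \<open>
  The numerical invariants below are maxima and minima of sets of natural numbers. For a finite
  digraph these sets are finite, and except for the chromatic number of a digraph with loops they
  are nonempty; outside that range the values are unspecified.
\<close>

definition independent_set :: "('a, 'b) pre_digraph \<Rightarrow> 'a set \<Rightarrow> bool" where
  "independent_set D S \<longleftrightarrow> S \<subseteq> verts D \<and> (\<forall>u\<in>S. \<forall>v\<in>S. \<not> u \<rightarrow>\<^bsub>D\<^esub> v)"

definition independence_number :: "('a, 'b) pre_digraph \<Rightarrow> nat" where
  "independence_number D = Max {card S | S. independent_set D S}"

text \<open>Parts of a \<^const>\<open>partition_on\<close> are nonempty by definition.\<close>

definition independent_partition :: "('a, 'b) pre_digraph \<Rightarrow> 'a set set \<Rightarrow> bool" where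
  "independent_partition D P \<longleftrightarrow>
     partition_on (verts D) P \<and> finite P \<and> (\<forall>S\<in>P. independent_set D S)"

definition multipartite :: "nat \<Rightarrow> ('a, 'b) pre_digraph \<Rightarrow> bool" where
  "multipartite p D \<longleftrightarrow> (\<exists>P. independent_partition D P \<and> card P = p)"

definition chromatic_number :: "('a, 'b) pre_digraph \<Rightarrow> nat" where
  "chromatic_number D = Min {card P | P. independent_partition D P}"

definition matching :: "('a, 'b) pre_digraph \<Rightarrow> 'b set \<Rightarrow> bool" where
  "matching D M \<longleftrightarrow> M \<subseteq> arcs D \<and> (\<forall>e\<in>M. tail D e \<noteq> head D e) \<and>
     (\<forall>e\<in>M. \<forall>f\<in>M. e \<noteq> f \<longrightarrow> {tail D e, head D e} \<inter> {tail D f, head D f} = {})"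

definition matching_number :: "('a, 'b) pre_digraph \<Rightarrow> nat" where
  "matching_number D = Max {card M | M. matching D M}"

definition dominating_set :: "('a, 'b) pre_digraph \<Rightarrow> 'a set \<Rightarrow> bool" where
  "dominating_set D S \<longleftrightarrow> S \<subseteq> verts D \<and> (\<forall>v\<in>verts D - S. \<exists>u\<in>S. u \<rightarrow>\<^bsub>D\<^esub> v)"

definition domination_number :: "('a, 'b) pre_digraph \<Rightarrow> nat" where
  "domination_number D = Min {card S | S. dominating_set D S}"

text \<open>
  The library predicates \<^const>\<open>forest\<close> and \<^const>\<open>tree\<close> only exclude directed cycles of the
  given digraph, so they do not speak about the underlying undirected graph. The latter is
  represented here by its symmetric digraph \<^const>\<open>mk_symmetric\<close>, in which a cycle of length
  2 is an edge traversed back and forth, and every other cycle is a cycle of the undirected graph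
  (a loop if its length is 1).
\<close>

definition underlying_tree :: "('a, 'b) pre_digraph \<Rightarrow> bool" where
  "underlying_tree T \<longleftrightarrow> connected T \<and>
     \<not> (\<exists>p. pre_digraph.cycle (with_proj (mk_symmetric T)) p \<and> length p \<noteq> 2)"

definition directed_spanning_tree ::
    "('a, 'b) pre_digraph \<Rightarrow> ('a, 'b) pre_digraph \<Rightarrow> 'a \<Rightarrow> bool" where
  "directed_spanning_tree D T r \<longleftrightarrow> r \<in> verts D \<and> spanning T D \<and> underlying_tree T \<and>
     (\<forall>v\<in>verts D - {r}. \<exists>!p. pre_digraph.apath T r p v)"

definition has_directed_spanning_tree :: "('a, 'b) pre_digraph \<Rightarrow> bool" where
  "has_directed_spanning_tree D \<longleftrightarrow> (\<exists>T r. directed_spanning_tree D T r)"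

text \<open>
  The vertices stand for holomorphic (\<open>V1\<close>), CR (\<open>V2\<close>), anti-invariant (\<open>V3\<close>), slant (\<open>V4\<close>) and
  hemi-slant (\<open>V6\<close>) submanifolds of almost Hermitian manifolds. There is no fifth vertex.
\<close>

datatype vertex = V1 | V2 | V3 | V4 | V6

definition D2 :: "(vertex, vertex \<times> vertex) pre_digraph" where
  "D2 = \<lparr> verts = {V1, V2, V3, V4, V6},
          arcs = {(V2, V1), (V2, V3), (V4, V1), (V4, V3), (V6, V1), (V6, V2), (V6, V3)},
          tail = fst, head = snd \<rparr>"

lemma digraph_D2: "digraph D2"
  by unfold_locales (auto simp: D2_def arc_to_ends_def)

end

theory Submission
  imports Defs
begin

text \<open>Each invariant gets an explicit witness and a matching bound. Disjoint arcs use two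
  vertices each, so five vertices allow at most two of them (\<open>matching_card_le\<close>). The
  maximal independent sets are \<open>{V1, V3}\<close>, \<open>{V2, V4}\<close> and
  \<open>{V4, V6}\<close>, all of size two. The first two together with \<open>{V6}\<close> give a
  partition into three classes, and fewer are impossible because \<open>V1\<close>,
  \<open>V2\<close>, \<open>V6\<close> are pairwise adjacent
  (\<open>clique_card_le_independent_partition\<close>). The last two claims rest on
  \<open>V4\<close> and \<open>V6\<close> being sources, that is, vertices without incoming arcs. A
  source must be the root of any directed spanning tree (\<open>source_is_root\<close>), and there
  cannot be two roots; a source also lies in every dominating set
  (\<open>source_in_dominating_set\<close>), and these two dominate the rest.\<close>

lemma Max_nat_collect_eqI:
  fixes f :: "'a \<Rightarrow> nat"
  assumes "Q x" and "f x = n" and bound: "\<And>y. Q y \<Longrightarrow> f y \<le> n"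
  shows "Max {f y | y. Q y} = n"
proof (rule Max_eqI)
  show "finite {f y | y. Q y}"
    by (rule finite_subset[of _ "{..n}"]) (use bound in auto)
qed (use assms in auto)

text \<open>A lower bound on the cardinalities does not make their set finite, as an upper bound
  does for \<open>Max\<close>; finiteness comes here from the finite universe
  \<open>U\<close>.\<close>

lemma Min_card_collect_eqI:
  assumes "finite U" and sub: "\<And>y. Q y \<Longrightarrow> y \<subseteq> U"
    and "Q x" and "card x = n" and "\<And>y. Q y \<Longrightarrow> n \<le> card y"
  shows "Min {card y | y. Q y} = n"
proof (rule Min_eqI)
  have "{y. Q y} \<subseteq> Pow U"
    using sub by auto
  then have "finite {y. Q y}"
    using \<open>finite U\<close> by (meson finite_Pow_iff finite_subset)
  then show "finite {card y | y. Q y}"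
    by simp
qed (use assms in auto)

text \<open>The end-vertex pairs of the arcs in \<open>M\<close> are disjoint two-element subsets of
  the vertex set, so their union has exactly \<open>2 * card M\<close> elements.\<close>

lemma (in fin_digraph) matching_card_le:
  assumes "matching G M"
  shows "2 * card M \<le> card (verts G)"
proof -
  let ?E = "\<lambda>e. {tail G e, head G e}"
  have M: "M \<subseteq> arcs G" "\<And>e. e \<in> M \<Longrightarrow> tail G e \<noteq> head G e"
    and disj: "\<forall>e\<in>M. \<forall>f\<in>M. e \<noteq> f \<longrightarrow> ?E e \<inter> ?E f = {}"
    using assms by (auto simp: matching_def)
  then have "finite M"
    using finite_arcs finite_subset by blast
  then have "card (\<Union>e\<in>M. ?E e) = (\<Sum>e\<in>M. card (?E e))"
    by (intro card_UN_disjoint disj) auto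
  also have "\<dots> = 2 * card M"
    using M(2) by simp
  finally show ?thesis
    using M(1) card_mono[OF finite_verts, of "\<Union>e\<in>M. ?E e"] by fastforce
qed

text \<open>Sending each vertex of the clique \<open>K\<close> to a class containing it is
  injective, since two adjacent vertices cannot share an independent class.\<close>

lemma clique_card_le_independent_partition:
  assumes P: "independent_partition D P" and "K \<subseteq> verts D"
    and adj: "\<And>u v. u \<in> K \<Longrightarrow> v \<in> K \<Longrightarrow> u \<noteq> v \<Longrightarrow> u \<rightarrow>\<^bsub>D\<^esub> v \<or> v \<rightarrow>\<^bsub>D\<^esub> u"
  shows "card K \<le> card P"
proof -
  have "\<forall>v\<in>K. \<exists>S\<in>P. v \<in> S"
    using P \<open>K \<subseteq> verts D\<close> by (auto simp: independent_partition_def partition_on_def)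
  then obtain part where part: "\<And>v. v \<in> K \<Longrightarrow> part v \<in> P \<and> v \<in> part v"
    by metis
  have "inj_on part K"
    using part adj P
    by (intro inj_onI) (metis independent_partition_def independent_set_def)
  with part P show ?thesis
    by (intro card_inj_on_le[of part]) (auto simp: independent_partition_def)
qed

lemma not_dominates_source:
  assumes "in_arcs D v = {}"
  shows "\<not> u \<rightarrow>\<^bsub>D\<^esub> v"
  using assms by (auto simp: in_arcs_def arcs_ends_def arc_to_ends_def)

lemma source_in_dominating_set:
  assumes "dominating_set D S" and "v \<in> verts D" and "in_arcs D v = {}"
  shows "v \<in> S"
  using assms(1,2) not_dominates_source[OF assms(3)] unfolding dominating_set_def by blast

text \<open>Any other vertex is reached from the root by a path of the tree, whose last arc would
  enter it.\<close>

lemma (in wf_digraph) source_is_root: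
  assumes "directed_spanning_tree G T r" and "v \<in> verts G" and "in_arcs G v = {}"
  shows "v = r"
proof (rule ccontr)
  assume "v \<noteq> r"
  with assms(1,2) obtain p where p: "pre_digraph.apath T r p v"
    unfolding directed_spanning_tree_def by blast
  have sub: "subgraph T G"
    using assms(1) by (auto simp: directed_spanning_tree_def spanning_def)
  then interpret T: wf_digraph T
    by auto
  have "r \<rightarrow>\<^sup>*\<^bsub>T\<^esub> v"
    using p T.reachable_awalk T.awalkI_apath by blast
  then have "r \<rightarrow>\<^sup>*\<^bsub>G\<^esub> v"
    using sub reachable_mono subgraph_def by blast
  \<comment> \<open>As \<open>v\<close> differs from \<open>r\<close>, the walk is nontrivial, and
    \<open>w\<close> is the tail of its last arc.\<close>
  with \<open>v \<noteq> r\<close> obtain w where "w \<rightarrow>\<^bsub>G\<^esub> v"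
    by (metis reachable_neq_reachable1 tranclD2)
  with not_dominates_source[OF assms(3)] show False
    by blast
qed

interpretation D2: digraph D2
  by (rule digraph_D2)

lemma adj_D2_iff: "u \<rightarrow>\<^bsub>D2\<^esub> v \<longleftrightarrow> (u, v) \<in> arcs D2"
  by (auto simp: D2_def arcs_ends_conv)

lemma in_arcs_D2: "in_arcs D2 V4 = {}" "in_arcs D2 V6 = {}"
  by (auto simp: in_arcs_def D2_def)

lemma independent_partition_D2: "independent_partition D2 {{V1, V3}, {V2, V4}, {V6}}"
  unfolding independent_partition_def independent_set_def adj_D2_iff partition_on_def disjoint_def
  by (auto simp: D2_def)

text \<open>With \<open>V4\<close> in \<open>S\<close>, both \<open>V1\<close> and \<open>V3\<close>
  are excluded, and \<open>V2\<close> and \<open>V6\<close> exclude each other. Without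
  \<open>V4\<close>, a member \<open>V2\<close> or \<open>V6\<close> is adjacent to every other
  candidate, so \<open>S\<close> is a singleton; otherwise only \<open>V1\<close> and
  \<open>V3\<close> remain.\<close>

lemma independent_set_D2_subset:
  assumes "independent_set D2 S"
  shows "S \<subseteq> {V1, V3} \<or> S \<subseteq> {V2, V4} \<or> S \<subseteq> {V4, V6}"
proof -
  have "S \<subseteq> {V1, V2, V3, V4, V6}"
    using assms by (simp add: independent_set_def D2_def)
  moreover have "\<forall>(u, v)\<in>arcs D2. \<not> (u \<in> S \<and> v \<in> S)"
    using assms unfolding independent_set_def adj_D2_iff by blast
  then have "\<not> (V2 \<in> S \<and> V1 \<in> S)" "\<not> (V2 \<in> S \<and> V3 \<in> S)" "\<not> (V4 \<in> S \<and> V1 \<in> S)"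
      "\<not> (V4 \<in> S \<and> V3 \<in> S)" "\<not> (V6 \<in> S \<and> V1 \<in> S)" "\<not> (V6 \<in> S \<and> V2 \<in> S)"
      "\<not> (V6 \<in> S \<and> V3 \<in> S)"
    by (simp_all add: D2_def)
  ultimately show ?thesis
    by (cases "V4 \<in> S"; cases "V2 \<in> S"; cases "V6 \<in> S") auto
qed

theorem theorem3p2:
  shows "multipartite 3 D2
    \<and> matching_number D2 = 2
    \<and> independence_number D2 = 2
    \<and> chromatic_number D2 = 3
    \<and> \<not> has_directed_spanning_tree D2
    \<and> domination_number D2 = 2"
proof (intro conjI)
  have card3: "card {{V1, V3}, {V2, V4}, {V6}} = 3"
    by (auto simp: card_insert_if doubleton_eq_iff)
  then show "multipartite 3 D2"
    using independent_partition_D2 unfolding multipartite_def by blast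
  show "matching_number D2 = 2"
    unfolding matching_number_def
  proof (rule Max_nat_collect_eqI)
    show "matching D2 {(V2, V1), (V4, V3)}"
      by (auto simp: matching_def D2_def)
    show "card M \<le> 2" if "matching D2 M" for M
      \<comment> \<open>There are five vertices, and \<open>2 * card M \<le> 5\<close> forces
        \<open>card M \<le> 2\<close>.\<close>
      using D2.matching_card_le[OF that] by (simp add: D2_def)
  qed simp
  show "independence_number D2 = 2"
    unfolding independence_number_def
  proof (rule Max_nat_collect_eqI)
    show "independent_set D2 {V1, V3}"
      using independent_partition_D2 by (simp add: independent_partition_def)
    show "card S \<le> 2" if S: "independent_set D2 S" for S
    proof -
      obtain a b where "S \<subseteq> {a, b}"
        using independent_set_D2_subset[OF S] by blast
      then have "card S \<le> card {a, b}"
        by (intro card_mono) auto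
      also have "\<dots> \<le> 2"
        by (simp add: card_insert_if)
      finally show ?thesis .
    qed
  qed simp
  show "chromatic_number D2 = 3"
    unfolding chromatic_number_def
  proof (rule Min_card_collect_eqI[where Q = "independent_partition D2",
        OF _ _ independent_partition_D2 card3])
    \<comment> \<open>A partition is a set of vertex sets, so the universe is the power set of the
      vertices.\<close>
    show "finite (Pow (verts D2))"
      by simp
    show "P \<subseteq> Pow (verts D2)" if "independent_partition D2 P" for P
      using that by (auto simp: independent_partition_def independent_set_def)
    show "3 \<le> card P" if "independent_partition D2 P" for P
    proof -
      \<comment> \<open>The triangle consists of the arcs \<open>(V2, V1)\<close>,
        \<open>(V6, V1)\<close> and \<open>(V6, V2)\<close>.\<close>
      have "card {V1, V2, V6} \<le> card P"
        by (rule clique_card_le_independent_partition[OF that])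
          (unfold adj_D2_iff, auto simp: D2_def)
      then show ?thesis
        by simp
    qed
  qed
  show "\<not> has_directed_spanning_tree D2"
  proof
    assume "has_directed_spanning_tree D2"
    then obtain T r where "directed_spanning_tree D2 T r"
      by (auto simp: has_directed_spanning_tree_def)
    from D2.source_is_root[OF this] have "V4 = r" "V6 = r"
      using in_arcs_D2 by (simp_all add: D2_def)
    then show False
      by simp
  qed
  show "domination_number D2 = 2"
    unfolding domination_number_def
  proof (rule Min_card_collect_eqI)
    show "finite (verts D2)"
      by simp
    show sub: "S \<subseteq> verts D2" if "dominating_set D2 S" for S
      using that by (simp add: dominating_set_def)
    \<comment> \<open>\<open>V6\<close> alone dominates \<open>V1\<close>, \<open>V2\<close> and
      \<open>V3\<close>; \<open>V4\<close> has to be included because nothing dominates it.\<close>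
    show "dominating_set D2 {V4, V6}"
      unfolding dominating_set_def adj_D2_iff by (auto simp: D2_def)
    show "2 \<le> card S" if "dominating_set D2 S" for S
    proof -
      have "{V4, V6} \<subseteq> S"
        using source_in_dominating_set[OF that] in_arcs_D2 by (simp add: D2_def)
      then have "card {V4, V6} \<le> card S"
        using sub[OF that] D2.finite_verts finite_subset by (intro card_mono) blast+
      then show ?thesis
        by simp
    qed
  qed simp
qed

end
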